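(* Let $TF$, $TW$, $TR$, $TS$ be floating point precisions (factorization, working, residual and solver precision, respectively) with $TS = TR > TW$. Let $A \in \mathcal{F}_W^{N\times N}$ and $b \in \mathcal{F}_W^N$ be a matrix and a right-hand side stored in the working precision $TW$, and let $I_W^R A \in \mathcal{F}_R^{N\times N}$ and $I_W^R b \in \mathcal{F}_R^N$ be their entrywise transfers (promotions) to the precision $TR$. Then the three-precision iterative refinement algorithm $$\text{IR-V1}(A, b, TF, TW, TR)$$ produces the same computed results as the two-precision algorithm $$\text{IR-V1}(I_W^R A,\ I_W^R b,\ TF,\ TR,\ TR),$$ i.e. the latter is the same algorithm applied to the promoted data with working precision equal to the residual precision $TR$.
   Context: **Precisions.** For a floating point precision $TX$, $\mathcal{F}_X$ denotes the set of floating point numbers of precision $TX$ and $fl_X$ denotes rounding to precision $TX$ (so $fl_X(x)=x$ for $x\in\mathcal{F}_X$). Precisions are ordered; $TL<TH$ means that $TH$ is a higher precision than $TL$. It is assumed that a lower precision number can be represented exactly in any higher precision: $\mathcal{F}_X \subset \mathcal{F}_Y$ if $TX \le TY$. **Interprecision transfers.** $I_A^B$ denotes the interprecision transfer from precision $TA$ to precision $TB$, applied entrywise to vectors and matrices. If $TA \le TB$ (upcasting when $TA<TB$), then $I_A^B(x) = x$ for all $x\in\mathcal{F}_A$ (the same number, now regarded as stored in precision $TB$). If $TA > TB$ (downcasting), then the value of $I_A^B(x)$ is the rounding $fl_B(x)$. **Mixed-precision operations.** When a binary operation $\circ$ is performed between floating point numbers of different precisions, the lower precision number is promoted first: if $TH>TL$,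 $u\in\mathcal{F}_H$, $v\in\mathcal{F}_L$, then $fl_H(u\circ v) = fl_H(u\circ (I_L^H v))$ and $fl_H(v\circ u) = fl_H((I_L^H v)\circ u)$. **Roles of the precisions.** $A$ and $b$ are stored in the working precision $TW$; the LU factorization is computed in the factorization precision $TF$ (intended to be a low precision); the residual is computed in the residual precision $TR$; the triangular solves are done in the solver precision $TS$. In Algorithm IR-V1 below, $TS=TR$. **Algorithm IR-V1$(A,b,TF,TW,TR)$** (inputs $A\in\mathcal{F}_W^{N\times N}$, $b\in\mathcal{F}_W^N$): 1. $x = 0 \in \mathcal{F}_R^N$. 2. $r = I_W^R(b)$. 3. $A_F = I_W^F(A)$. 4. Factor $A_F = LU$ in precision $TF$ (the computed LU factors $L,U$ have entries in $\mathcal{F}_F$). 5. While $\|r\|$ is too large: (a) $d = ((I_F^R L)(I_F^R U))^{-1} r$, computed in precision $TR$ (by triangular solves with the promoted factors); (b) $x \leftarrow x + d$ (in precision $TR$); (c) $r = (I_W^R b) - (I_W^R A)\,x$ (computed in precision $TR$). Here $\|\cdot\|$ is the $\ell^\infty$ norm. The factorization, triangular solve, matrix-vector product and vector operations are fixed deterministic floating point procedures, the same in both runs being compared, and the same test for "$\|r\|$ is too large" is used in both runs. "Produces the same computed results" means that the computed quantities of the two runs (the factors $L,U$ and all the computed $d$, $x$, $r$ in each iteration, hence also the final output $x$) coincide. *)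

theory Defs
  imports "HOL-Analysis.Analysis" "HOL-Library.While_Combinator"
begin

text \<open>
  The type of precisions is linearly ordered, \<open>X < Y\<close> meaning that \<open>Y\<close> is the higher precision.
  \<open>FP X\<close> is the set of floating point numbers of precision \<open>X\<close> and \<open>fl X\<close> rounds to
  precision \<open>X\<close>. Neither a format nor a rounding mode is fixed; infinities and NaNs are not
  modelled.
\<close>

locale float_system =
  fixes FP :: "'p::linorder \<Rightarrow> real set"
    and fl :: "'p \<Rightarrow> real \<Rightarrow> real"
  assumes zero_in: "0 \<in> FP X"
    and fl_in: "fl X x \<in> FP X"
    and fl_id: "x \<in> FP X \<Longrightarrow> fl X x = x"
    and FP_mono: "X \<le> Y \<Longrightarrow> FP X \<subseteq> FP Y"

definition fp_vec :: "('p \<Rightarrow> real set) \<Rightarrow> 'p \<Rightarrow> real^'n \<Rightarrow> bool" where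
  "fp_vec FP X v \<longleftrightarrow> (\<forall>i. v $ i \<in> FP X)"

definition fp_mat :: "('p \<Rightarrow> real set) \<Rightarrow> 'p \<Rightarrow> real^'n^'n \<Rightarrow> bool" where
  "fp_mat FP X M \<longleftrightarrow> (\<forall>i j. M $ i $ j \<in> FP X)"

text \<open>Interprecision transfer from \<open>X\<close> to \<open>Y\<close>; it is meant for arguments in \<open>FP X\<close>.\<close>

definition ipt :: "('p::linorder \<Rightarrow> real \<Rightarrow> real) \<Rightarrow> 'p \<Rightarrow> 'p \<Rightarrow> real \<Rightarrow> real" where
  "ipt fl X Y x = (if X \<le> Y then x else fl Y x)"

definition ipt_vec :: "('p::linorder \<Rightarrow> real \<Rightarrow> real) \<Rightarrow> 'p \<Rightarrow> 'p \<Rightarrow> real^'n \<Rightarrow> real^'n" where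
  "ipt_vec fl X Y v = (\<chi> i. ipt fl X Y (v $ i))"

definition ipt_mat :: "('p::linorder \<Rightarrow> real \<Rightarrow> real) \<Rightarrow> 'p \<Rightarrow> 'p \<Rightarrow> real^'n^'n \<Rightarrow> real^'n^'n" where
  "ipt_mat fl X Y M = (\<chi> i j. ipt fl X Y (M $ i $ j))"

text \<open>
  The deterministic floating point procedures used by the algorithm. The first argument is the
  precision in which the procedure is carried out; the operands are already stored in that
  precision. Being functions, the procedures are deterministic; apart from this their
  implementation (pivoting, order of summation, etc.) is left open.
\<close>

record ('p, 'n) fp_procs =
  lu_factor :: "'p \<Rightarrow> real^'n^'n \<Rightarrow> (real^'n^'n) \<times> (real^'n^'n)"
  lower_solve :: "'p \<Rightarrow> real^'n^'n \<Rightarrow> real^'n \<Rightarrow> real^'n"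
  upper_solve :: "'p \<Rightarrow> real^'n^'n \<Rightarrow> real^'n \<Rightarrow> real^'n"
  mat_vec :: "'p \<Rightarrow> real^'n^'n \<Rightarrow> real^'n \<Rightarrow> real^'n"
  vec_add :: "'p \<Rightarrow> real^'n \<Rightarrow> real^'n \<Rightarrow> real^'n"
  vec_sub :: "'p \<Rightarrow> real^'n \<Rightarrow> real^'n \<Rightarrow> real^'n"

text \<open>Procedures carried out in precision \<open>X\<close> return data of precision \<open>X\<close>.\<close>

definition fp_closed :: "('p \<Rightarrow> real set) \<Rightarrow> ('p, 'n::finite) fp_procs \<Rightarrow> bool" where
  "fp_closed FP P \<longleftrightarrow> (\<forall>X.
     (\<forall>M. fp_mat FP X M \<longrightarrow>
        fp_mat FP X (fst (lu_factor P X M)) \<and> fp_mat FP X (snd (lu_factor P X M))) \<and>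
     (\<forall>M v. fp_mat FP X M \<longrightarrow> fp_vec FP X v \<longrightarrow>
        fp_vec FP X (lower_solve P X M v) \<and> fp_vec FP X (upper_solve P X M v) \<and>
        fp_vec FP X (mat_vec P X M v)) \<and>
     (\<forall>u v. fp_vec FP X u \<longrightarrow> fp_vec FP X v \<longrightarrow>
        fp_vec FP X (vec_add P X u v) \<and> fp_vec FP X (vec_sub P X u v)))"

text \<open>
  The state after some number of passes through the loop; \<open>corr\<close> is the correction \<open>d\<close> computed
  in the last pass, \<open>None\<close> before the first one.
\<close>

record 'v ir_state =
  corr :: "'v option"
  sol :: 'v
  resid :: 'v

definition ir_init :: "('p::linorder \<Rightarrow> real \<Rightarrow> real) \<Rightarrow> real^'n \<Rightarrow> 'p \<Rightarrow> 'p \<Rightarrow> (real^'n) ir_state" where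
  "ir_init fl b TW TR = \<lparr>corr = None, sol = 0, resid = ipt_vec fl TW TR b\<rparr>"

definition ir_factors ::
  "('p::linorder \<Rightarrow> real \<Rightarrow> real) \<Rightarrow> ('p, 'n::finite) fp_procs \<Rightarrow> real^'n^'n \<Rightarrow> 'p \<Rightarrow> 'p \<Rightarrow>
   (real^'n^'n) \<times> (real^'n^'n)" where
  "ir_factors fl P A TF TW = lu_factor P TF (ipt_mat fl TW TF A)"

definition ir_step ::
  "('p::linorder \<Rightarrow> real \<Rightarrow> real) \<Rightarrow> ('p, 'n::finite) fp_procs \<Rightarrow> real^'n^'n \<Rightarrow> real^'n \<Rightarrow>
   'p \<Rightarrow> 'p \<Rightarrow> 'p \<Rightarrow> (real^'n) ir_state \<Rightarrow> (real^'n) ir_state" where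
  "ir_step fl P A b TF TW TR s =
     (let (L, U) = ir_factors fl P A TF TW;
          d = upper_solve P TR (ipt_mat fl TF TR U)
                (lower_solve P TR (ipt_mat fl TF TR L) (resid s));
          x = vec_add P TR (sol s) d;
          r = vec_sub P TR (ipt_vec fl TW TR b) (mat_vec P TR (ipt_mat fl TW TR A) x)
      in \<lparr>corr = Some d, sol = x, resid = r\<rparr>)"

text \<open>
  The computed results of a run: the factors, the state after each pass \<open>k\<close> through the loop
  (\<open>None\<close> if the loop has been left before \<open>k\<close> passes), and the final \<open>x\<close> (\<open>None\<close> if the loop does
  not terminate). \<open>too_large\<close> is the stopping test, applied to the maximum norm of the residual.
\<close>

record ('m, 'v) ir_results =
  factors :: "'m \<times> 'm"
  iterates :: "nat \<Rightarrow> 'v ir_state option"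
  final :: "'v option"

definition ir_v1 ::
  "('p::linorder \<Rightarrow> real \<Rightarrow> real) \<Rightarrow> ('p, 'n::finite) fp_procs \<Rightarrow> (real \<Rightarrow> bool) \<Rightarrow>
   real^'n^'n \<Rightarrow> real^'n \<Rightarrow> 'p \<Rightarrow> 'p \<Rightarrow> 'p \<Rightarrow> (real^'n^'n, real^'n) ir_results" where
  "ir_v1 fl P too_large A b TF TW TR =
     (let init = ir_init fl b TW TR;
          step = ir_step fl P A b TF TW TR;
          continue = (\<lambda>s. too_large (infnorm (resid s)))
      in \<lparr>factors = ir_factors fl P A TF TW,
          iterates = (\<lambda>k. if \<forall>j<k. continue ((step ^^ j) init)
                          then Some ((step ^^ k) init) else None),
          final = map_option sol (while_option continue step init)\<rparr>)"

end

theory Submission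
  imports Defs
begin

text \<open>
  The data \<open>A\<close> and \<open>b\<close> enter a run only through transfers out of the working precision:
  \<open>A\<close> is transferred to \<open>TF\<close> for the factorization, and \<open>A\<close> and \<open>b\<close> are transferred to \<open>TR\<close> for
  the residual. So the two runs coincide as soon as promoting a number from \<open>TW\<close> to \<open>TR\<close> and
  then transferring it to \<open>TF\<close> or \<open>TR\<close> gives the same number as the direct transfer. This is
  lemma \<open>ipt_promote\<close>. Only the transfer to \<open>TF\<close> needs an argument, and there only the case
  \<open>TW \<le> TF < TR\<close>: the direct transfer is then an upcast and the other one ends with a rounding,
  but this rounding is exact because the number already lies in \<open>FP TW \<subseteq> FP TF\<close>.
\<close>

lemma (in float_system) ipt_promote:
  assumes "X \<le> Y" and "x \<in> FP X"
  shows "ipt fl Y Z (ipt fl X Y x) = ipt fl X Z x"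
proof (cases "X \<le> Z")
  case True
  then have "fl Z x = x"
    using FP_mono assms(2) by (blast intro: fl_id)
  with True assms(1) show ?thesis
    by (simp add: ipt_def)
next
  case False
  with assms(1) have "\<not> Y \<le> Z"
    by (meson order_trans)
  with False assms(1) show ?thesis
    by (simp add: ipt_def)
qed

lemma (in float_system) ipt_vec_promote:
  assumes "X \<le> Y" and "fp_vec FP X v"
  shows "ipt_vec fl Y Z (ipt_vec fl X Y v) = ipt_vec fl X Z v"
  using assms by (simp add: ipt_vec_def fp_vec_def ipt_promote)

lemma (in float_system) ipt_mat_promote:
  assumes "X \<le> Y" and "fp_mat FP X M"
  shows "ipt_mat fl Y Z (ipt_mat fl X Y M) = ipt_mat fl X Z M"
  using assms by (simp add: ipt_mat_def fp_mat_def ipt_promote)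

theorem theorem3p1:
  fixes FP :: "'p::linorder \<Rightarrow> real set"
    and fl :: "'p \<Rightarrow> real \<Rightarrow> real"
    and P :: "('p, 'n::finite) fp_procs"
    and too_large :: "real \<Rightarrow> bool"
    and TF TW TR TS :: 'p
    and A :: "real^'n^'n" and b :: "real^'n"
  assumes "float_system FP fl"
    and "fp_closed FP P"
    and "TS = TR" and "TR > TW"
    and "fp_mat FP TW A" and "fp_vec FP TW b"
  shows "ir_v1 fl P too_large A b TF TW TR =
         ir_v1 fl P too_large (ipt_mat fl TW TR A) (ipt_vec fl TW TR b) TF TR TR"
proof -
  interpret float_system FP fl by fact
  have le: "TW \<le> TR"
    using \<open>TR > TW\<close> by simp
  note promote = ipt_mat_promote [OF le \<open>fp_mat FP TW A\<close>] ipt_vec_promote [OF le \<open>fp_vec FP TW b\<close>]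
  have factors: "ir_factors fl P (ipt_mat fl TW TR A) TF TR = ir_factors fl P A TF TW"
    by (simp add: ir_factors_def promote)
  have init: "ir_init fl (ipt_vec fl TW TR b) TR TR = ir_init fl b TW TR"
    by (simp add: ir_init_def promote)
  have step: "ir_step fl P (ipt_mat fl TW TR A) (ipt_vec fl TW TR b) TF TR TR =
      ir_step fl P A b TF TW TR"
    by (rule ext) (simp only: ir_step_def factors promote)
  show ?thesis
    by (simp only: ir_v1_def factors init step)
qed

end
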